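(* A framed motion $g_t$ of $(S,\gamma)$ on $\tilde S$ along $\tilde\gamma$ is a standard rolling if and only if for all $t\in J$ $$\kappa_g(t)=\tilde\kappa_g(t)\quad\text{and}\quad \kappa_n(t)\neq\tilde\kappa_n(t),$$ where $\kappa_g,\kappa_n$ are the geodesic curvature and the normal curvature of $\gamma$ on $S$, and $\tilde\kappa_g,\tilde\kappa_n$ are the geodesic curvature and the normal curvature of $\tilde\gamma$ on $\tilde S$.
   Context: $S$ and $\tilde S$ are smooth surfaces in $\mathbb{R}^3$, $J=[0,\alpha]$, and $\gamma:J\to S$ is a smooth regular curve with $\gamma(0)=(0,0,0)$. The Darboux frame field of $\gamma$ is $\{e,h,N\}$, where $N(t)$ is a (smoothly chosen) unit normal vector to $S$ at $\gamma(t)$, $e(t)=\gamma'(t)/\|\gamma'(t)\|$ and $h(t)=N(t)\times e(t)$. The geodesic curvature $\kappa_g$, normal curvature $\kappa_n$ and geodesic torsion $\tau_g$ are defined by $e'=\|\gamma'\|(\kappa_g h+\kappa_n N)$, $h'=\|\gamma'\|(-\kappa_g e+\tau_g N)$, $N'=\|\gamma'\|(-\kappa_n e-\tau_g h)$. The curve $\tilde\gamma:J\to\tilde S$ is smooth and regular with $\tilde\gamma(0)=\gamma(0)$, $\tilde\gamma'(0)=\gamma'(0)$ and $\|\tilde\gamma'\|=\|\gamma'\|$ on $J$; its Darboux frame field $\{\tilde e,\tilde h=\tilde N\times\tilde e,\tilde N\}$ on $\tilde S$ and the functions $\tilde\kappa_g,\tilde\kappa_n,\tilde\tau_g$ are defined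 in the same way. Let $E^+(3)$ be the group of direct isometries of $\mathbb{R}^3$. A framed motion of $(S,\gamma)$ on $\tilde S$ along $\tilde\gamma$ is a differentiable map $J\to E^+(3)$, $t\mapsto g_t$, such that for each $t$ the isometry $g_t$ maps $\gamma(t)$ to $\tilde\gamma(t)$, $\gamma(t)+e(t)$ to $\tilde\gamma(t)+\tilde e(t)$, and $\gamma(t)+N(t)$ to $\tilde\gamma(t)+\tilde N(t)$. Write $g_t(x)=R_tx+c_t$ with $R_t\in SO(3)$, and put $\Omega_t=R_t'R_t^{\mathsf T}$ (a skew-symmetric matrix). The motion is rotational if $\Omega_t\neq0$ for all $t\in J$; then the angular velocity vector $\omega_t\ne 0$ is the unique vector with $\omega_t\times x=\Omega_tx$ for all $x\in\mathbb{R}^3$. A standard rolling is a rotational framed motion for which there exist smooth functions $a,b$ on $J$ with $\omega_t=a(t)\tilde e(t)+b(t)\tilde h(t)$ and $b(t)\neq0$ for all $t\in J$ (i.e. no spinning component along $\tilde N$, and not a pure twisting, which means $\omega_t$ proportional to $\tilde e(t)$). *)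

theory Defs
  imports "HOL-Analysis.Analysis"
begin

(* Derivatives are taken within S, so a single notion serves maps on an open set and, with
   one-sided derivatives at the endpoints, curves on a compact interval.  On both kinds of
   domain (for intervals: of positive length) the derivative f' is unique. *)
primrec Ck_on :: "nat \<Rightarrow> 'a::real_normed_vector set \<Rightarrow> ('a \<Rightarrow> 'b::real_normed_vector) \<Rightarrow> bool" where
  "Ck_on 0 S f \<longleftrightarrow> continuous_on S f"
| "Ck_on (Suc k) S f \<longleftrightarrow>
     (\<exists>f'. (\<forall>x\<in>S. (f has_derivative f' x) (at x within S)) \<and> (\<forall>v. Ck_on k S (\<lambda>x. f' x v)))"

definition smooth_on :: "'a::real_normed_vector set \<Rightarrow> ('a \<Rightarrow> 'b::real_normed_vector) \<Rightarrow> bool" where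
  "smooth_on S f \<longleftrightarrow> (\<forall>k. Ck_on k S f)"

(* Regular embedded surface: locally the image of a smooth immersion of an open subset of the
   plane that is a homeomorphism onto a relatively open piece of S. *)
definition smooth_surface :: "(real^3) set \<Rightarrow> bool" where
  "smooth_surface S \<longleftrightarrow>
     (\<forall>p\<in>S. \<exists>V U (\<phi> :: real^2 \<Rightarrow> real^3) \<psi>.
        open V \<and> p \<in> V \<and> open U \<and> smooth_on U \<phi> \<and> homeomorphism U (S \<inter> V) \<phi> \<psi> \<and>
        (\<forall>q\<in>U. inj (frechet_derivative \<phi> (at q))))"

definition tangent_space :: "(real^3) set \<Rightarrow> real^3 \<Rightarrow> (real^3) set" where
  "tangent_space S p =
     {v. \<exists>\<epsilon>>0. \<exists>c. smooth_on {-\<epsilon><..<\<epsilon>} c \<and> c ` {-\<epsilon><..<\<epsilon>} \<subseteq> S \<and> c 0 = p \<and>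
           (c has_vector_derivative v) (at 0)}"

definition unit_normal :: "(real^3) set \<Rightarrow> real^3 \<Rightarrow> real^3 \<Rightarrow> bool" where
  "unit_normal S p n \<longleftrightarrow> norm n = 1 \<and> (\<forall>v\<in>tangent_space S p. n \<bullet> v = 0)"

abbreviation velocity :: "real set \<Rightarrow> (real \<Rightarrow> 'a::real_normed_vector) \<Rightarrow> real \<Rightarrow> 'a" where
  "velocity J \<gamma> t \<equiv> vector_derivative \<gamma> (at t within J)"

definition regular_curve_on :: "real set \<Rightarrow> (real^3) set \<Rightarrow> (real \<Rightarrow> real^3) \<Rightarrow> bool" where
  "regular_curve_on J S \<gamma> \<longleftrightarrow>
     smooth_on J \<gamma> \<and> \<gamma> ` J \<subseteq> S \<and> (\<forall>t\<in>J. velocity J \<gamma> t \<noteq> 0)"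

definition smooth_unit_normal_along ::
    "real set \<Rightarrow> (real^3) set \<Rightarrow> (real \<Rightarrow> real^3) \<Rightarrow> (real \<Rightarrow> real^3) \<Rightarrow> bool" where
  "smooth_unit_normal_along J S \<gamma> N \<longleftrightarrow>
     smooth_on J N \<and> (\<forall>t\<in>J. unit_normal S (\<gamma> t) (N t))"

definition darboux_e :: "real set \<Rightarrow> (real \<Rightarrow> real^3) \<Rightarrow> real \<Rightarrow> real^3" where
  "darboux_e J \<gamma> t = velocity J \<gamma> t /\<^sub>R norm (velocity J \<gamma> t)"

definition darboux_h ::
    "real set \<Rightarrow> (real \<Rightarrow> real^3) \<Rightarrow> (real \<Rightarrow> real^3) \<Rightarrow> real \<Rightarrow> real^3" where
  "darboux_h J \<gamma> N t = cross3 (N t) (darboux_e J \<gamma> t)"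

(* Darboux equations at t for the values kg, kn, tg of the geodesic curvature, the normal
   curvature and the geodesic torsion. *)
definition darboux_equations ::
    "real set \<Rightarrow> (real \<Rightarrow> real^3) \<Rightarrow> (real \<Rightarrow> real^3) \<Rightarrow> real \<Rightarrow> real \<times> real \<times> real \<Rightarrow> bool" where
  "darboux_equations J \<gamma> N t = (\<lambda>(kg, kn, tg).
     let e = darboux_e J \<gamma>; h = darboux_h J \<gamma> N; s = norm (velocity J \<gamma> t) in
       (e has_vector_derivative s *\<^sub>R (kg *\<^sub>R h t + kn *\<^sub>R N t)) (at t within J) \<and>
       (h has_vector_derivative s *\<^sub>R (- kg *\<^sub>R e t + tg *\<^sub>R N t)) (at t within J) \<and>
       (N has_vector_derivative s *\<^sub>R (- kn *\<^sub>R e t - tg *\<^sub>R h t)) (at t within J))"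

definition geodesic_curvature ::
    "real set \<Rightarrow> (real \<Rightarrow> real^3) \<Rightarrow> (real \<Rightarrow> real^3) \<Rightarrow> real \<Rightarrow> real" where
  "geodesic_curvature J \<gamma> N t = fst (THE k. darboux_equations J \<gamma> N t k)"

definition normal_curvature ::
    "real set \<Rightarrow> (real \<Rightarrow> real^3) \<Rightarrow> (real \<Rightarrow> real^3) \<Rightarrow> real \<Rightarrow> real" where
  "normal_curvature J \<gamma> N t = fst (snd (THE k. darboux_equations J \<gamma> N t k))"

(* For an isometry x \<mapsto> R *v x + c these are R and c. *)
definition linear_part :: "(real^3 \<Rightarrow> real^3) \<Rightarrow> real^3^3" where
  "linear_part g = matrix (\<lambda>x. g x - g 0)"

definition translation_part :: "(real^3 \<Rightarrow> real^3) \<Rightarrow> real^3" where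
  "translation_part g = g 0"

definition direct_isometries :: "(real^3 \<Rightarrow> real^3) set" where
  "direct_isometries =
     {g. (\<forall>x y. dist (g x) (g y) = dist x y) \<and> det (linear_part g) = 1}"

lemma direct_isometries_eq:
  "direct_isometries = {\<lambda>x. R *v x + c | R c. rotation_matrix R}"
proof (intro equalityI subsetI)
  fix g :: "real^3 \<Rightarrow> real^3"
  assume g: "g \<in> direct_isometries"
  let ?f = "\<lambda>x. g x - g 0"
  have f: "orthogonal_transformation ?f"
    using g unfolding orthogonal_transformation_isometry direct_isometries_def
    by (simp add: dist_norm)
  then have "rotation_matrix (linear_part g)"
    using g unfolding orthogonal_transformation_matrix rotation_matrix_def
    by (simp add: direct_isometries_def linear_part_def)
  moreover have "g = (\<lambda>x. linear_part g *v x + g 0)"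
    using f by (simp add: linear_part_def matrix_works orthogonal_transformation_linear)
  ultimately show "g \<in> {\<lambda>x. R *v x + c | R c. rotation_matrix R}"
    by blast
next
  fix g :: "real^3 \<Rightarrow> real^3"
  assume "g \<in> {\<lambda>x. R *v x + c | R c. rotation_matrix R}"
  then obtain R c where R: "rotation_matrix R" and g: "g = (\<lambda>x. R *v x + c)"
    by blast
  have lp: "linear_part g = R"
    by (simp add: linear_part_def g)
  have "orthogonal_transformation ((*v) R)"
    using R by (simp add: orthogonal_transformation_matrix rotation_matrix_def)
  then have "dist (g x) (g y) = dist x y" for x y
    unfolding orthogonal_transformation_isometry by (simp add: g)
  then show "g \<in> direct_isometries"
    using R lp by (simp add: direct_isometries_def rotation_matrix_def)
qed

(* Differentiability of t \<mapsto> g t as a map into the group of direct isometries is that of its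
   matrix and translation components, i.e. in SO(3) \<times> R^3. *)
definition framed_motion ::
    "real set \<Rightarrow> (real \<Rightarrow> real^3) \<Rightarrow> (real \<Rightarrow> real^3) \<Rightarrow> (real \<Rightarrow> real^3) \<Rightarrow> (real \<Rightarrow> real^3) \<Rightarrow>
     (real \<Rightarrow> real^3 \<Rightarrow> real^3) \<Rightarrow> bool" where
  "framed_motion J \<gamma> N \<gamma>2 N2 g \<longleftrightarrow>
     (\<forall>t\<in>J. g t \<in> direct_isometries) \<and>
     (\<lambda>t. linear_part (g t)) differentiable_on J \<and>
     (\<lambda>t. translation_part (g t)) differentiable_on J \<and>
     (\<forall>t\<in>J. g t (\<gamma> t) = \<gamma>2 t \<and>
            g t (\<gamma> t + darboux_e J \<gamma> t) = \<gamma>2 t + darboux_e J \<gamma>2 t \<and>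
            g t (\<gamma> t + N t) = \<gamma>2 t + N2 t)"

definition angular_matrix :: "real set \<Rightarrow> (real \<Rightarrow> real^3 \<Rightarrow> real^3) \<Rightarrow> real \<Rightarrow> real^3^3" where
  "angular_matrix J g t =
     vector_derivative (\<lambda>s. linear_part (g s)) (at t within J) ** transpose (linear_part (g t))"

definition angular_velocity :: "real set \<Rightarrow> (real \<Rightarrow> real^3 \<Rightarrow> real^3) \<Rightarrow> real \<Rightarrow> real^3" where
  "angular_velocity J g t = (THE w. \<forall>x. cross3 w x = angular_matrix J g t *v x)"

definition rotational :: "real set \<Rightarrow> (real \<Rightarrow> real^3 \<Rightarrow> real^3) \<Rightarrow> bool" where
  "rotational J g \<longleftrightarrow> (\<forall>t\<in>J. angular_matrix J g t \<noteq> 0)"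

definition standard_rolling ::
    "real set \<Rightarrow> (real \<Rightarrow> real^3) \<Rightarrow> (real \<Rightarrow> real^3) \<Rightarrow> (real \<Rightarrow> real^3) \<Rightarrow> (real \<Rightarrow> real^3) \<Rightarrow>
     (real \<Rightarrow> real^3 \<Rightarrow> real^3) \<Rightarrow> bool" where
  "standard_rolling J \<gamma> N \<gamma>2 N2 g \<longleftrightarrow>
     framed_motion J \<gamma> N \<gamma>2 N2 g \<and> rotational J g \<and>
     (\<exists>a b :: real \<Rightarrow> real. smooth_on J a \<and> smooth_on J b \<and>
        (\<forall>t\<in>J. angular_velocity J g t = a t *\<^sub>R darboux_e J \<gamma>2 t + b t *\<^sub>R darboux_h J \<gamma>2 N2 t \<and>
               b t \<noteq> 0))"

end

theory Submission
  imports Defs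
begin

text \<open>
  Differentiating \<open>R e = e2\<close>, \<open>R h = h2\<close>, \<open>R N = N2\<close> along the curve shows that the angular matrix
  \<open>R' R\<^sup>T\<close> maps each vector of the second frame to the difference of its derivative and the
  \<open>R\<close>-image of the derivative of the corresponding vector of the first frame. By the Darboux
  equations, with \<open>s\<close> the common speed, the angular velocity is therefore
  \<open>s ((tg2 - tg) e2 + (kn - kn2) h2 + (kg2 - kg) N2)\<close>.
\<close>

section \<open>Functions of class \<open>C\<^sup>k\<close>\<close>

text \<open>A derivative within \<open>S\<close> depends only on the values on \<open>S\<close>, so
  the same \<open>f'\<close> serves both functions.\<close>

lemma Ck_on_cong:
  "(\<And>x. x \<in> S \<Longrightarrow> f x = g x) \<Longrightarrow> Ck_on k S f \<Longrightarrow> Ck_on k S g"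
proof (induction k)
  case 0
  then show ?case by (simp cong: continuous_on_cong)
next
  case (Suc k)
  then obtain f' where "\<And>x. x \<in> S \<Longrightarrow> (f has_derivative f' x) (at x within S)"
    and "\<And>v. Ck_on k S (\<lambda>x. f' x v)" by auto
  moreover have "(g has_derivative f' x) (at x within S)" if "x \<in> S" for x
    by (rule has_derivative_transform[OF that _ calculation(1)[OF that]]) (simp add: Suc.prems)
  ultimately show ?case by auto
qed

text \<open>The order drops by one in each directional derivative by induction; the base case is
  continuity of differentiable maps. Only the outermost layer of \<open>Ck_on\<close> is unfolded,
  so that the hypothesis applies to the inner one.\<close>

lemma Ck_on_SucD: "Ck_on (Suc k) S f \<Longrightarrow> Ck_on k S f"
proof (induction k arbitrary: f)
  case 0
  then show ?case
    by (auto simp: continuous_on_eq_continuous_within intro: has_derivative_continuous)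
next
  case (Suc k)
  then obtain f' where "\<forall>x\<in>S. (f has_derivative f' x) (at x within S)"
    and "\<forall>v. Ck_on (Suc k) S (\<lambda>x. f' x v)"
    by (auto simp only: Ck_on.simps(2)[of "Suc k"])
  then show ?case using Suc.IH by (auto simp only: Ck_on.simps(2)[of k])
qed

lemma Ck_on_const: "Ck_on k S (\<lambda>x. c)"
proof (induction k arbitrary: c)
  case (Suc k)
  then show ?case by (auto intro!: exI[of _ "\<lambda>x v. 0"])
qed simp

lemma Ck_on_add: "Ck_on k S f \<Longrightarrow> Ck_on k S g \<Longrightarrow> Ck_on k S (\<lambda>x. f x + g x)"
proof (induction k arbitrary: f g)
  case 0
  then show ?case by (simp add: continuous_on_add)
next
  case (Suc k)
  then obtain f' g' where "\<forall>x\<in>S. (f has_derivative f' x) (at x within S)"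
    "\<forall>v. Ck_on k S (\<lambda>x. f' x v)" "\<forall>x\<in>S. (g has_derivative g' x) (at x within S)"
    "\<forall>v. Ck_on k S (\<lambda>x. g' x v)" by auto
  with Suc.IH show ?case
    by (auto intro!: exI[of _ "\<lambda>x v. f' x v + g' x v"] has_derivative_add)
qed

text \<open>The product rule yields two terms, each again \<open>p\<close> applied to functions of
  class \<open>k\<close>. This covers multiplication, scaling, inner products and cross products at
  once.\<close>

lemma Ck_on_bilinear:
  assumes "bounded_bilinear p"
  shows "Ck_on k S f \<Longrightarrow> Ck_on k S g \<Longrightarrow> Ck_on k S (\<lambda>x. p (f x) (g x))"
proof (induction k arbitrary: f g)
  case 0
  then show ?case by (simp add: bounded_bilinear.continuous_on[OF assms])
next
  case (Suc k)
  obtain f' where f': "\<forall>x\<in>S. (f has_derivative f' x) (at x within S)"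
    "\<forall>v. Ck_on k S (\<lambda>x. f' x v)" using Suc.prems(1) by auto
  obtain g' where g': "\<forall>x\<in>S. (g has_derivative g' x) (at x within S)"
    "\<forall>v. Ck_on k S (\<lambda>x. g' x v)" using Suc.prems(2) by auto
  have "Ck_on k S f" "Ck_on k S g" using Suc.prems by (auto intro: Ck_on_SucD simp del: Ck_on.simps)
  then have "Ck_on k S (\<lambda>x. p (f x) (g' x v) + p (f' x v) (g x))" for v
    using f'(2) g'(2) Suc.IH by (intro Ck_on_add) blast+
  moreover have "((\<lambda>x. p (f x) (g x)) has_derivative (\<lambda>v. p (f x) (g' x v) + p (f' x v) (g x)))
      (at x within S)" if "x \<in> S" for x
    using bounded_bilinear.FDERIV[OF assms] f'(1) g'(1) that by blast
  ultimately show ?case by (auto intro!: exI[of _ "\<lambda>x v. p (f x) (g' x v) + p (f' x v) (g x)"])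
qed

text \<open>Differentiation lowers the exponent to \<open>p - 1\<close>, so the induction runs over
  all exponents; positivity of \<open>f\<close> keeps every power differentiable.\<close>

lemma Ck_on_powr:
  fixes f :: "'a::real_normed_vector \<Rightarrow> real"
  assumes "\<And>x. x \<in> S \<Longrightarrow> 0 < f x"
  shows "Ck_on k S f \<Longrightarrow> Ck_on k S (\<lambda>x. f x powr p)"
proof (induction k arbitrary: p)
  case 0
  then show ?case using assms by (force intro!: continuous_on_powr continuous_on_const)
next
  case (Suc k)
  obtain f' where f': "\<forall>x\<in>S. (f has_derivative f' x) (at x within S)"
    "\<forall>v. Ck_on k S (\<lambda>x. f' x v)" using Suc.prems(1) by auto
  have "Ck_on k S f" using Suc.prems by (rule Ck_on_SucD)
  then have "Ck_on k S (\<lambda>x. p * (f x powr (p - 1) * f' x v))" for v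
    using Suc.IH f'(2) by (intro Ck_on_bilinear[OF bounded_bilinear_mult] Ck_on_const) auto
  moreover have "((\<lambda>x. f x powr p) has_derivative (\<lambda>v. p * (f x powr (p - 1) * f' x v)))
      (at x within S)" if "x \<in> S" for x
  proof -
    \<comment> \<open>The general rule allows a varying exponent; the summand with factor 0 comes
      from the derivative of the constant \<open>p\<close>.\<close>
    have "((\<lambda>x. f x powr p) has_derivative (\<lambda>h. f x powr p * (0 * ln (f x) + f' x h * p / f x)))
        (at x within S)"
      using f'(1) assms that by (intro has_derivative_powr) auto
    moreover have "f x powr p * (0 * ln (f x) + f' x h * p / f x) = p * (f x powr (p - 1) * f' x h)" for h
      using assms[OF that] by (simp add: powr_diff)
    ultimately show ?thesis by simp
  qed
  ultimately show ?case by (auto intro!: exI[of _ "\<lambda>x v. p * (f x powr (p - 1) * f' x v)"])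
qed

lemma Ck_on_compose_translation:
  fixes f :: "real \<Rightarrow> 'b::real_normed_vector"
  assumes "\<And>x. x \<in> T \<Longrightarrow> a + x \<in> S"
  shows "Ck_on k S f \<Longrightarrow> Ck_on k T (\<lambda>x. f (a + x))"
proof (induction k arbitrary: f)
  case 0
  then show ?case using assms
    by (auto intro!: continuous_on_compose2[where f = "\<lambda>x. a + x"] continuous_intros)
next
  case (Suc k)
  then obtain f' where f': "\<forall>x\<in>S. (f has_derivative f' x) (at x within S)"
    "\<forall>v. Ck_on k S (\<lambda>x. f' x v)" by auto
  have "((\<lambda>x. f (a + x)) has_derivative f' (a + x)) (at x within T)" if "x \<in> T" for x
  proof -
    have "(f has_derivative f' (a + x)) (at (a + x) within (\<lambda>x. a + x) ` T)"
      by (rule has_derivative_subset[of _ _ _ S]) (use f' assms that in auto)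
    moreover have "((\<lambda>x. a + x) has_derivative (\<lambda>x. x)) (at x within T)"
      by (auto intro!: derivative_eq_intros)
    ultimately show ?thesis
      using has_derivative_in_compose[of "\<lambda>x. a + x" "\<lambda>x. x" x T f "f' (a + x)"] by simp
  qed
  then show ?case using Suc.IH f'(2) by (auto intro!: exI[of _ "\<lambda>x. f' (a + x)"])
qed

section \<open>Smooth functions: closure properties, normalization and velocities\<close>

lemma smooth_on_bilinear:
  "bounded_bilinear p \<Longrightarrow> smooth_on S f \<Longrightarrow> smooth_on S g \<Longrightarrow> smooth_on S (\<lambda>x. p (f x) (g x))"
  by (simp add: smooth_on_def Ck_on_bilinear)

lemma smooth_on_add: "smooth_on S f \<Longrightarrow> smooth_on S g \<Longrightarrow> smooth_on S (\<lambda>x. f x + g x)"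
  by (simp add: smooth_on_def Ck_on_add)

lemma smooth_on_uminus:
  fixes f :: "'a::real_normed_vector \<Rightarrow> real"
  assumes "smooth_on S f"
  shows "smooth_on S (\<lambda>x. - f x)"
proof -
  have "smooth_on S (\<lambda>x. -1 * f x)"
    using assms
    by (intro smooth_on_bilinear[OF bounded_bilinear_mult]) (simp_all add: smooth_on_def Ck_on_const)
  then show ?thesis by simp
qed

lemma smooth_on_diff:
  fixes f :: "'a::real_normed_vector \<Rightarrow> real"
  assumes "smooth_on S f" and "smooth_on S g"
  shows "smooth_on S (\<lambda>x. f x - g x)"
  using smooth_on_add[OF assms(1) smooth_on_uminus[OF assms(2)]] by simp

lemma smooth_on_cong:
  "(\<And>x. x \<in> S \<Longrightarrow> f x = g x) \<Longrightarrow> smooth_on S f \<Longrightarrow> smooth_on S g"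
  unfolding smooth_on_def by (blast intro: Ck_on_cong)

lemma smooth_on_imp_continuous_on: "smooth_on S f \<Longrightarrow> continuous_on S f"
  by (drule smooth_on_def[THEN iffD1, THEN spec[of _ 0]]) simp

text \<open>Away from zeros of \<open>f\<close> the reciprocal norm is the power \<open>-1/2\<close>
  of the positive smooth function \<open>f x \<bullet> f x\<close>.\<close>

lemma smooth_on_normalized:
  fixes f :: "'a::real_normed_vector \<Rightarrow> 'b::real_inner"
  assumes f: "smooth_on S f" and nz: "\<And>x. x \<in> S \<Longrightarrow> f x \<noteq> 0"
  shows "smooth_on S (\<lambda>x. f x /\<^sub>R norm (f x))"
proof -
  have "smooth_on S (\<lambda>x. f x \<bullet> f x)" by (rule smooth_on_bilinear[OF bounded_bilinear_inner f f])
  then have "smooth_on S (\<lambda>x. (f x \<bullet> f x) powr (-1/2))"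
    using nz by (auto simp: smooth_on_def intro: Ck_on_powr)
  then have *: "smooth_on S (\<lambda>x. (f x \<bullet> f x) powr (-1/2) *\<^sub>R f x)"
    by (rule smooth_on_bilinear[OF bounded_bilinear_scaleR]) fact
  show ?thesis
  proof (rule smooth_on_cong[OF _ *])
    fix x assume "x \<in> S"
    then show "(f x \<bullet> f x) powr (-1/2) *\<^sub>R f x = f x /\<^sub>R norm (f x)"
      using nz by (simp add: norm_eq_sqrt_inner powr_minus powr_half_sqrt)
  qed
qed

lemma smooth_on_has_velocity:
  fixes f :: "real \<Rightarrow> 'b::real_normed_vector"
  assumes "smooth_on J f" and "t \<in> J"
  shows "(f has_vector_derivative velocity J f t) (at t within J)"
proof -
  have "Ck_on (Suc 0) J f" using assms(1) by (simp add: smooth_on_def del: Ck_on.simps)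
  then have "f differentiable at t within J" using assms(2) by (auto simp: differentiable_def)
  then show ?thesis by (simp add: vector_derivative_works)
qed

text \<open>The velocity is the derivative in direction 1, which is of class \<open>k\<close> by
  definition. Since no point of \<open>J\<close> is isolated, derivatives within \<open>J\<close>
  are unique, so \<open>velocity\<close> picks exactly this one.\<close>

lemma smooth_on_velocity:
  fixes f :: "real \<Rightarrow> 'b::real_normed_vector"
  assumes "smooth_on J f" and nt: "\<And>t. t \<in> J \<Longrightarrow> at t within J \<noteq> bot"
  shows "smooth_on J (velocity J f)"
  unfolding smooth_on_def
proof
  fix k
  have "Ck_on (Suc k) J f" using assms(1) by (simp add: smooth_on_def del: Ck_on.simps)
  then obtain f' where f': "\<forall>x\<in>J. (f has_derivative f' x) (at x within J)"
    "\<forall>v. Ck_on k J (\<lambda>x. f' x v)" by auto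
  have "f' t 1 = velocity J f t" if "t \<in> J" for t
  proof -
    have "(f has_vector_derivative f' t 1) (at t within J)"
    proof -
      have f: "(f has_derivative f' t) (at t within J)" using f'(1) that by blast
      then have "f' t h = h *\<^sub>R f' t 1" for h
        using linear_simps(5)[OF has_derivative_bounded_linear[OF f], of h 1] by simp
      then have "f' t = (\<lambda>h. h *\<^sub>R f' t 1)" by blast
      then show ?thesis using f by (simp add: has_vector_derivative_def)
    qed
    then show ?thesis by (rule vector_derivative_within[OF nt[OF that], symmetric])
  qed
  then show "Ck_on k J (velocity J f)"
    by (rule Ck_on_cong[of J "\<lambda>t. f' t 1"]) (use f'(2) in blast)+
qed

section \<open>Orthonormal frames of Euclidean 3-space\<close>

lemma bounded_bilinear_cross3: "bounded_bilinear cross3"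
  using bilinear_cross bilinear_conv_bounded_bilinear by blast

lemma bounded_bilinear_matrix_vector_mult:
  "bounded_bilinear ((*v) :: real^'n^'m \<Rightarrow> real^'n \<Rightarrow> real^'m)"
proof -
  have "bilinear ((*v) :: real^'n^'m \<Rightarrow> real^'n \<Rightarrow> real^'m)"
    unfolding bilinear_def
    by (auto intro!: linearI simp: matrix_vector_right_distrib matrix_vector_mult_add_rdistrib
        matrix_vector_mult_scaleR scaleR_matrix_vector_assoc)
  then show ?thesis using bilinear_conv_bounded_bilinear by blast
qed

text \<open>The third vector is the cross product of the other two, as in \<open>darboux_h\<close>,
  so the frame \<open>e\<close>, \<open>h\<close>, \<open>N\<close> is orthonormal and positively
  oriented by construction.\<close>

locale orthonormal_pair =
  fixes e N :: "real^3"
  assumes ee: "e \<bullet> e = 1" and NN: "N \<bullet> N = 1" and eN: "e \<bullet> N = 0"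
begin

abbreviation "h \<equiv> cross3 N e"

lemma inner_frame:
  "h \<bullet> h = 1" "e \<bullet> h = 0" "h \<bullet> e = 0" "h \<bullet> N = 0" "N \<bullet> h = 0" "N \<bullet> e = 0"
  using ee NN eN inner_commute[of N e] by (simp_all add: dot_cross dot_cross_self)

lemmas inner_frame_simps = ee NN eN inner_frame

lemma cross_frame:
  "cross3 e h = N" "cross3 h e = - N" "cross3 h N = e" "cross3 N h = - e" "cross3 e N = - h"
  using inner_frame_simps by (simp_all add: Lagrange cross_skew[of h e] cross_skew[of h N] cross_skew[of e N])

text \<open>The remainder \<open>d\<close> is orthogonal to \<open>e\<close>, \<open>h\<close> and
  \<open>N\<close>. By the double cross product formula, orthogonality to \<open>e\<close> and
  \<open>N\<close> makes \<open>d\<close> parallel to \<open>h\<close>; being also orthogonal to the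
  nonzero \<open>h\<close>, it vanishes.\<close>

lemma expansion: "x = (x \<bullet> e) *\<^sub>R e + (x \<bullet> h) *\<^sub>R h + (x \<bullet> N) *\<^sub>R N"
proof -
  define d where "d = x - ((x \<bullet> e) *\<^sub>R e + (x \<bullet> h) *\<^sub>R h + (x \<bullet> N) *\<^sub>R N)"
  have "d \<bullet> e = 0" "d \<bullet> h = 0" "d \<bullet> N = 0"
    by (simp_all add: d_def inner_diff_left inner_add_left inner_frame_simps)
  then have "cross3 d h = 0" by (simp add: Lagrange)
  with \<open>d \<bullet> h = 0\<close> have "d = 0 \<or> h = 0" using norm_and_cross_eq_0 by blast
  then have "d = 0" using inner_frame(1) by force
  then show ?thesis by (simp add: d_def)
qed

lemma linear_eqI:
  assumes "linear f" and "linear g" and "f e = g e" and "f h = g h" and "f N = g N"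
  shows "f x = g x"
proof -
  let ?y = "(x \<bullet> e) *\<^sub>R e + (x \<bullet> h) *\<^sub>R h + (x \<bullet> N) *\<^sub>R N"
  have "f ?y = g ?y" by (simp add: assms linear_add linear_scale)
  then show ?thesis by (simp flip: expansion)
qed

lemma frame_coeff_unique:
  assumes "a *\<^sub>R e + b *\<^sub>R h + c *\<^sub>R N = a' *\<^sub>R e + b' *\<^sub>R h + c' *\<^sub>R N"
  shows "a = a'" and "b = b'" and "c = c'"
  using arg_cong[OF assms, of "\<lambda>x. x \<bullet> e"] arg_cong[OF assms, of "\<lambda>x. x \<bullet> h"]
    arg_cong[OF assms, of "\<lambda>x. x \<bullet> N"]
  by (simp_all add: inner_add_left inner_frame_simps)

end

section \<open>The Darboux frame\<close>

text \<open>Near an interior parameter the curve itself, shifted so that \<open>t\<close> moves to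
  0, is a witness for \<open>tangent_space\<close>.\<close>

lemma interior_velocity_in_tangent_space:
  assumes \<gamma>: "smooth_on J \<gamma>" "\<gamma> ` J \<subseteq> S" and t: "t \<in> interior J"
  shows "velocity J \<gamma> t \<in> tangent_space S (\<gamma> t)"
proof -
  obtain \<epsilon> where \<epsilon>: "0 < \<epsilon>" "ball t \<epsilon> \<subseteq> J" using t mem_interior by blast
  have sub: "t + x \<in> J" if "x \<in> {-\<epsilon><..<\<epsilon>}" for x
    using \<epsilon>(2) that by (force simp: dist_real_def subset_iff)
  have "smooth_on {-\<epsilon><..<\<epsilon>} (\<lambda>x. \<gamma> (t + x))"
    using \<gamma>(1) sub unfolding smooth_on_def by (blast intro: Ck_on_compose_translation)
  moreover have "((\<lambda>x. \<gamma> (t + x)) has_vector_derivative velocity J \<gamma> t) (at 0)"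
  proof -
    have "(\<gamma> has_vector_derivative velocity J \<gamma> t) (at t within J)"
      using \<gamma>(1) t interior_subset by (blast intro: smooth_on_has_velocity)
    then have "(\<gamma> has_vector_derivative velocity J \<gamma> t) (at (t + 0))"
      by (simp add: at_within_interior[OF t])
    then have "(\<gamma> \<circ> (\<lambda>x. t + x) has_vector_derivative 1 *\<^sub>R velocity J \<gamma> t) (at 0)"
      by (intro vector_diff_chain_at)
        (auto simp flip: has_real_derivative_iff_has_vector_derivative intro!: derivative_eq_intros)
    then show ?thesis by (simp add: o_def)
  qed
  moreover have "(\<lambda>x. \<gamma> (t + x)) ` {-\<epsilon><..<\<epsilon>} \<subseteq> S" using sub \<gamma>(2) by blast
  ultimately show ?thesis
    unfolding tangent_space_def using \<epsilon>(1)
    by (intro CollectI exI[of _ \<epsilon>] conjI exI[of _ "\<lambda>x. \<gamma> (t + x)"]) simp_all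
qed

text \<open>At an endpoint of \<open>J\<close> a curve in \<open>S\<close> need not extend to an open interval within \<open>S\<close>, so
  orthogonality there is obtained by continuity.\<close>

lemma unit_normal_orthogonal_velocity:
  assumes J: "J \<subseteq> closure (interior J)" "\<And>t. t \<in> J \<Longrightarrow> at t within J \<noteq> bot"
    and \<gamma>: "regular_curve_on J S \<gamma>" and N: "smooth_unit_normal_along J S \<gamma> N" and t: "t \<in> J"
  shows "N t \<bullet> velocity J \<gamma> t = 0"
proof -
  have "continuous_on J (\<lambda>t. N t \<bullet> velocity J \<gamma> t)"
    using \<gamma> N J(2) unfolding regular_curve_on_def smooth_unit_normal_along_def
    by (intro smooth_on_imp_continuous_on smooth_on_bilinear[OF bounded_bilinear_inner]
        \<comment> \<open>Continuity of the inner product makes its zero set closed relative to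
          \<open>J\<close>, hence the trace on \<open>J\<close> of a closed set \<open>C\<close>.
          Once \<open>C\<close> contains the interior of \<open>J\<close>, it contains all of
          \<open>J\<close>.\<close>
        smooth_on_velocity) auto
  then have "closedin (top_of_set J) {t \<in> J. N t \<bullet> velocity J \<gamma> t = 0}"
    by (rule continuous_closedin_preimage_constant)
  then obtain C where C: "closed C" "{t \<in> J. N t \<bullet> velocity J \<gamma> t = 0} = J \<inter> C"
    by (auto simp: closedin_closed)
  have "N s \<bullet> velocity J \<gamma> s = 0" if "s \<in> interior J" for s
    using interior_velocity_in_tangent_space[OF _ _ that] \<gamma> N that interior_subset
    unfolding regular_curve_on_def smooth_unit_normal_along_def unit_normal_def by blast
  then have "interior J \<subseteq> C" using C(2) interior_subset by blast
  then have "t \<in> C" using C(1) J(1) t closure_minimal by blast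
  then show ?thesis using C(2) t by blast
qed

section \<open>The Darboux equations and their coefficients\<close>

locale darboux_frame =
  fixes J :: "real set" and \<gamma> N :: "real \<Rightarrow> real^3"
  assumes nontrivial: "\<And>t. t \<in> J \<Longrightarrow> at t within J \<noteq> bot"
    and smooth_curve: "smooth_on J \<gamma>" and smooth_normal: "smooth_on J N"
    and regular: "\<And>t. t \<in> J \<Longrightarrow> velocity J \<gamma> t \<noteq> 0"
    and unit: "\<And>t. t \<in> J \<Longrightarrow> norm (N t) = 1"
    and normal: "\<And>t. t \<in> J \<Longrightarrow> N t \<bullet> velocity J \<gamma> t = 0"
begin

abbreviation "e \<equiv> darboux_e J \<gamma>"
abbreviation "h \<equiv> darboux_h J \<gamma> N"
abbreviation "s \<equiv> \<lambda>t. norm (velocity J \<gamma> t)"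

text \<open>The three independent entries of the skew-symmetric matrix of frame derivatives, per
  unit of arc length. They are explicit candidates for the values described by \<open>THE\<close> in
  the curvatures.\<close>

definition kg where "kg t = (velocity J e t \<bullet> h t) / s t"
definition kn where "kn t = (velocity J e t \<bullet> N t) / s t"
definition tg where "tg t = (velocity J h t \<bullet> N t) / s t"

lemma pair: "t \<in> J \<Longrightarrow> orthonormal_pair (e t) (N t)"
proof
  assume t: "t \<in> J"
  have "norm (e t) = 1" using regular[OF t] by (simp add: darboux_e_def)
  then show "e t \<bullet> e t = 1" by (simp only: norm_eq_1)
  show "N t \<bullet> N t = 1" using unit[OF t] by (simp only: norm_eq_1)
  show "e t \<bullet> N t = 0" using normal[OF t] inner_commute[of "N t" "velocity J \<gamma> t"] by (simp add: darboux_e_def)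
qed

lemma smooth_e: "smooth_on J e"
proof -
  have "smooth_on J (\<lambda>t. velocity J \<gamma> t /\<^sub>R norm (velocity J \<gamma> t))"
    by (intro smooth_on_normalized smooth_on_velocity smooth_curve nontrivial regular)
  then show ?thesis by (simp add: darboux_e_def[abs_def])
qed

lemma smooth_h: "smooth_on J h"
proof -
  have "smooth_on J (\<lambda>t. cross3 (N t) (e t))"
    by (intro smooth_on_bilinear[OF bounded_bilinear_cross3] smooth_normal smooth_e)
  then show ?thesis by (simp only: darboux_h_def[abs_def])
qed

text \<open>The product with the speed is the coefficient occurring in the angular velocity; the
  division in \<open>kn\<close> cancels, leaving an inner product of smooth functions.\<close>

lemma smooth_kn: "smooth_on J (\<lambda>t. s t * kn t)"
proof (rule smooth_on_cong)
  show "smooth_on J (\<lambda>t. velocity J e t \<bullet> N t)"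
    by (intro smooth_on_bilinear[OF bounded_bilinear_inner] smooth_on_velocity smooth_e
        nontrivial smooth_normal)
  show "velocity J e t \<bullet> N t = s t * kn t" if "t \<in> J" for t
    using regular[OF that] by (simp add: kn_def)
qed

lemma smooth_tg: "smooth_on J (\<lambda>t. s t * tg t)"
proof (rule smooth_on_cong)
  show "smooth_on J (\<lambda>t. velocity J h t \<bullet> N t)"
    by (intro smooth_on_bilinear[OF bounded_bilinear_inner] smooth_on_velocity smooth_h
        nontrivial smooth_normal)
  show "velocity J h t \<bullet> N t = s t * tg t" if "t \<in> J" for t
    using regular[OF that] by (simp add: tg_def)
qed

text \<open>Differentiate the constant function \<open>u t \<bullet> v t\<close>. For
  \<open>u = v\<close> this says that the velocity is orthogonal to the vector itself.\<close>

lemma inner_velocity_skew: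
  assumes u: "smooth_on J u" and v: "smooth_on J v"
    and const: "\<And>t. t \<in> J \<Longrightarrow> u t \<bullet> v t = c" and t: "t \<in> J"
  shows "velocity J u t \<bullet> v t = - (velocity J v t \<bullet> u t)"
proof -
  have "((\<lambda>t. u t \<bullet> v t) has_vector_derivative u t \<bullet> velocity J v t + velocity J u t \<bullet> v t)
      (at t within J)"
    using u v t by (intro bounded_bilinear.has_vector_derivative[OF bounded_bilinear_inner]
        smooth_on_has_velocity)
  moreover have "((\<lambda>t. u t \<bullet> v t) has_vector_derivative 0) (at t within J)"
    by (rule has_vector_derivative_transform[OF t const]) auto
  ultimately have "u t \<bullet> velocity J v t + velocity J u t \<bullet> v t = 0"
    using vector_derivative_unique_within[OF nontrivial[OF t]] by blast
  then show ?thesis by (simp add: inner_commute)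
qed

lemma darboux_equations_darboux_frame:
  assumes t: "t \<in> J"
  shows "darboux_equations J \<gamma> N t (kg t, kn t, tg t)"
proof -
  have h: "h t = cross3 (N t) (e t)" for t by (simp add: darboux_h_def)
  note ip = orthonormal_pair.inner_frame_simps[OF pair, folded h]
  \<comment> \<open>The matrix of frame derivatives is skew-symmetric. The facts \<open>ip\<close>
    numbered 1, 4, 2 are the unit lengths of \<open>e\<close>, \<open>h\<close>, \<open>N\<close>;
    those numbered 6, 9, 8 are the orthogonality of the pairs \<open>h\<close>, \<open>e\<close>,
    then \<open>N\<close>, \<open>e\<close>, then \<open>N\<close>, \<open>h\<close>.\<close>
  have d: "velocity J e t \<bullet> e t = 0" "velocity J h t \<bullet> h t = 0" "velocity J N t \<bullet> N t = 0"
    "velocity J h t \<bullet> e t = - (velocity J e t \<bullet> h t)"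
    "velocity J N t \<bullet> e t = - (velocity J e t \<bullet> N t)"
    "velocity J N t \<bullet> h t = - (velocity J h t \<bullet> N t)"
    using inner_velocity_skew[OF smooth_e smooth_e ip(1) t]
      inner_velocity_skew[OF smooth_h smooth_h ip(4) t]
      inner_velocity_skew[OF smooth_normal smooth_normal ip(2) t]
      inner_velocity_skew[OF smooth_h smooth_e ip(6) t]
      inner_velocity_skew[OF smooth_normal smooth_e ip(9) t]
      inner_velocity_skew[OF smooth_normal smooth_h ip(8) t] by simp_all
  have x: "x = (x \<bullet> e t) *\<^sub>R e t + (x \<bullet> h t) *\<^sub>R h t + (x \<bullet> N t) *\<^sub>R N t" for x
    using orthonormal_pair.expansion[OF pair[OF t]] by (simp add: h)
  have "velocity J e t = s t *\<^sub>R (kg t *\<^sub>R h t + kn t *\<^sub>R N t)"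
    "velocity J h t = s t *\<^sub>R (- kg t *\<^sub>R e t + tg t *\<^sub>R N t)"
    "velocity J N t = s t *\<^sub>R (- kn t *\<^sub>R e t - tg t *\<^sub>R h t)"
    using regular[OF t]
    by (subst x, simp add: d kg_def kn_def tg_def scaleR_add_right scaleR_diff_right)+
  then show ?thesis
    using smooth_on_has_velocity[OF smooth_e t] smooth_on_has_velocity[OF smooth_h t]
      smooth_on_has_velocity[OF smooth_normal t]
    by (simp add: darboux_equations_def)
qed

text \<open>Inner products of the first equation with \<open>h\<close> and \<open>N\<close>, and of
  the second with \<open>N\<close>, recover the three values after division by the nonzero
  speed.\<close>

lemma darboux_equations_unique:
  assumes t: "t \<in> J" and "darboux_equations J \<gamma> N t k"
  shows "k = (kg t, kn t, tg t)"
proof -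
  obtain a b c where k: "k = (a, b, c)" by (cases k) auto
  have h: "h t = cross3 (N t) (e t)" by (simp add: darboux_h_def)
  note ip = orthonormal_pair.inner_frame_simps[OF pair[OF t], folded h]
  have "velocity J e t = s t *\<^sub>R (a *\<^sub>R h t + b *\<^sub>R N t)"
    "velocity J h t = s t *\<^sub>R (- a *\<^sub>R e t + c *\<^sub>R N t)"
    using assms(2) unfolding k darboux_equations_def Let_def prod.case
    by (blast intro: vector_derivative_within[OF nontrivial[OF t]])+
  then show ?thesis
    using regular[OF t] by (simp add: k kg_def kn_def tg_def inner_add_left inner_diff_left ip)
qed

lemma curvatures:
  assumes "t \<in> J"
  shows "geodesic_curvature J \<gamma> N t = kg t" "normal_curvature J \<gamma> N t = kn t"
proof -
  have "(THE k. darboux_equations J \<gamma> N t k) = (kg t, kn t, tg t)"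
    using darboux_equations_darboux_frame[OF assms] darboux_equations_unique[OF assms] by blast
  then show "geodesic_curvature J \<gamma> N t = kg t" "normal_curvature J \<gamma> N t = kn t"
    by (simp_all add: geodesic_curvature_def normal_curvature_def)
qed

end

text \<open>Positive length guarantees that no point of \<open>J\<close> is isolated and that the
  endpoints are limits of interior points, as the continuity argument for \<open>normal\<close>
  requires.\<close>

lemma darboux_frameI:
  assumes "0 < \<alpha>" and "J = {0..\<alpha>}"
    and "regular_curve_on J S \<gamma>" and "smooth_unit_normal_along J S \<gamma> N"
  shows "darboux_frame J \<gamma> N"
proof -
  have nt: "at t within J \<noteq> bot" if "t \<in> J" for t
    using assms(1,2) that by (simp add: trivial_limit_within islimpt_Icc)
  have cl: "J \<subseteq> closure (interior J)" using assms(1,2) by simp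
  show ?thesis
    using assms(3,4) unit_normal_orthogonal_velocity[OF cl nt assms(3,4)] nt
    by unfold_locales (auto simp: regular_curve_on_def smooth_unit_normal_along_def unit_normal_def)
qed

section \<open>Angular velocity of a framed motion\<close>

text \<open>Two candidates differ by a vector whose cross product with everything is 0, hence by
  0.\<close>

lemma angular_velocity_eqI:
  assumes "\<And>x. cross3 w x = angular_matrix J g t *v x"
  shows "angular_velocity J g t = w"
  unfolding angular_velocity_def
proof (rule the_equality)
  fix w' assume "\<forall>x. cross3 w' x = angular_matrix J g t *v x"
  then have "cross3 (w' - w) x = 0" for x
    using assms by (simp add: Cross3.left_diff_distrib)
  then show "w' = w" using cross_basis_nonzero[of "w' - w"] by auto
qed (use assms in blast)

locale framed_motion_pair =
  A: darboux_frame J \<gamma> N + B: darboux_frame J \<gamma>2 N2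
  for J :: "real set" and \<gamma> \<gamma>2 N N2 :: "real \<Rightarrow> real^3" +
  fixes g :: "real \<Rightarrow> real^3 \<Rightarrow> real^3"
  assumes speed: "\<And>t. t \<in> J \<Longrightarrow> norm (velocity J \<gamma>2 t) = norm (velocity J \<gamma> t)"
    and motion: "framed_motion J \<gamma> N \<gamma>2 N2 g"
begin

abbreviation "R \<equiv> \<lambda>t. linear_part (g t)"

lemma rotation: "t \<in> J \<Longrightarrow> rotation_matrix (R t)"
  and affine: "t \<in> J \<Longrightarrow> g t x = R t *v x + g t 0"
proof -
  assume "t \<in> J"
  then have "g t \<in> direct_isometries" using motion by (simp add: framed_motion_def)
  then obtain M c where M: "g t = (\<lambda>x. M *v x + c)" "rotation_matrix M"
    unfolding direct_isometries_eq by blast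
  then have "R t = M" by (simp add: linear_part_def)
  with M show "rotation_matrix (R t)" "g t x = R t *v x + g t 0" by simp_all
qed

text \<open>Subtracting the images of two points cancels the translation, which gives the claims for
  \<open>e\<close> and \<open>N\<close>. A rotation preserves cross products, which gives the one
  for \<open>h\<close>.\<close>

lemma rotation_frame:
  assumes "t \<in> J"
  shows "R t *v A.e t = B.e t" "R t *v N t = N2 t" "R t *v A.h t = B.h t"
proof -
  have diff: "R t *v x = g t (\<gamma> t + x) - g t (\<gamma> t)" for x
    using affine[OF assms, of "\<gamma> t + x"] affine[OF assms, of "\<gamma> t"]
    by (simp add: matrix_vector_right_distrib)
  show e: "R t *v A.e t = B.e t" and N: "R t *v N t = N2 t"
    using motion assms by (simp_all add: diff framed_motion_def)
  show "R t *v A.h t = B.h t"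
    using cross_rotation_matrix[OF rotation[OF assms], of "N t" "A.e t"]
    by (simp add: e N darboux_h_def)
qed

text \<open>Differentiating \<open>R u = v\<close> gives \<open>v' = R u' + R' u\<close>, and
  orthogonality of \<open>R\<close> turns \<open>u\<close> into the transpose of \<open>R\<close>
  applied to \<open>v\<close>.\<close>

lemma angular_matrix_mult:
  assumes t: "t \<in> J" and img: "\<And>t. t \<in> J \<Longrightarrow> R t *v u t = v t"
    and u: "(u has_vector_derivative u') (at t within J)"
    and v: "(v has_vector_derivative v') (at t within J)"
  shows "angular_matrix J g t *v v t = v' - R t *v u'"
proof -
  have "(R has_vector_derivative velocity J R t) (at t within J)"
    using motion t by (auto simp: framed_motion_def differentiable_on_def vector_derivative_works)
  then have "((\<lambda>t. R t *v u t) has_vector_derivative R t *v u' + velocity J R t *v u t) (at t within J)"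
    using u by (rule bounded_bilinear.has_vector_derivative[OF bounded_bilinear_matrix_vector_mult])
  then have "(v has_vector_derivative R t *v u' + velocity J R t *v u t) (at t within J)"
    using has_vector_derivative_transform[OF t, of v "\<lambda>t. R t *v u t"] img by simp
  with v have "v' = R t *v u' + velocity J R t *v u t"
    using vector_derivative_unique_within[OF A.nontrivial[OF t]] by blast
  moreover have "transpose (R t) *v v t = u t"
    using rotation[OF t] img[OF t, symmetric]
    by (simp add: matrix_vector_mul_assoc rotation_matrix_def orthogonal_matrix)
  ultimately show ?thesis
    by (simp add: angular_matrix_def flip: matrix_vector_mul_assoc)
qed

text \<open>Both sides are linear in \<open>x\<close>, so it suffices to compare them on the second
  Darboux frame. Skew-symmetry of the angular matrix comes out as a consequence.\<close>

lemma cross_angular_velocity: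
  assumes t: "t \<in> J"
  defines "w \<equiv> A.s t *\<^sub>R ((B.tg t - A.tg t) *\<^sub>R B.e t + (A.kn t - B.kn t) *\<^sub>R B.h t
    + (B.kg t - A.kg t) *\<^sub>R N2 t)"
  shows "cross3 w x = angular_matrix J g t *v x"
proof -
  interpret F: orthonormal_pair "B.e t" "N2 t" by (rule B.pair[OF t])
  have h: "cross3 (N2 t) (B.e t) = B.h t" by (simp add: darboux_h_def)
  note cf = F.cross_frame[unfolded h] h
  note dA = A.darboux_equations_darboux_frame[OF t, unfolded darboux_equations_def Let_def prod.case]
  \<comment> \<open>Rewriting with \<open>speed\<close> gives both sets of Darboux equations the
    common factor \<open>A.s t\<close>.\<close>
  note dB = B.darboux_equations_darboux_frame[OF t, unfolded darboux_equations_def Let_def prod.case speed[OF t]]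
  note rf = rotation_frame[OF t]
  note lin = bounded_bilinear.minus_right[OF bounded_bilinear_matrix_vector_mult]
    matrix_vector_right_distrib matrix_vector_mult_diff_distrib matrix_vector_mult_scaleR rf
    cross_add_left cross_mult_left cf
  have "cross3 w (B.e t) = angular_matrix J g t *v B.e t"
    using angular_matrix_mult[OF t rotation_frame(1) conjunct1[OF dA] conjunct1[OF dB]]
    by (simp add: w_def lin) (simp add: algebra_simps)
  moreover have "cross3 w (B.h t) = angular_matrix J g t *v B.h t"
    using angular_matrix_mult[OF t rotation_frame(3)
        conjunct1[OF conjunct2[OF dA]] conjunct1[OF conjunct2[OF dB]]]
    by (simp add: w_def lin) (simp add: algebra_simps)
  moreover have "cross3 w (N2 t) = angular_matrix J g t *v N2 t"
    using angular_matrix_mult[OF t rotation_frame(2)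
        conjunct2[OF conjunct2[OF dA]] conjunct2[OF conjunct2[OF dB]]]
    by (simp add: w_def lin) (simp add: algebra_simps)
  moreover have "linear (cross3 w)" using bilinear_cross by (simp add: bilinear_def)
  ultimately show ?thesis
    using F.linear_eqI[of "cross3 w" "(*v) (angular_matrix J g t)" x] by (simp add: h)
qed

lemmas angular_velocity_eq = angular_velocity_eqI[OF cross_angular_velocity]

text \<open>Since the speed is nonzero, the spinning component along \<open>N2\<close> vanishes
  exactly when the geodesic curvatures agree, and the component along \<open>h\<close> is nonzero
  exactly when the normal curvatures differ.\<close>

lemma standard_rolling_iff:
  "standard_rolling J \<gamma> N \<gamma>2 N2 g \<longleftrightarrow> (\<forall>t\<in>J. A.kg t = B.kg t \<and> A.kn t \<noteq> B.kn t)"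
proof
  assume "standard_rolling J \<gamma> N \<gamma>2 N2 g"
  then obtain a b where ab: "\<And>t. t \<in> J \<Longrightarrow>
      angular_velocity J g t = a t *\<^sub>R B.e t + b t *\<^sub>R B.h t \<and> b t \<noteq> 0"
    unfolding standard_rolling_def by blast
  show "\<forall>t\<in>J. A.kg t = B.kg t \<and> A.kn t \<noteq> B.kn t"
  proof
    fix t assume t: "t \<in> J"
    interpret F: orthonormal_pair "B.e t" "N2 t" by (rule B.pair[OF t])
    have h: "B.h t = cross3 (N2 t) (B.e t)" by (simp add: darboux_h_def)
    \<comment> \<open>The missing spinning component is written as an explicit coefficient 0, so
      that coefficients in the frame can be compared.\<close>
    have "(A.s t * (B.tg t - A.tg t)) *\<^sub>R B.e t + (A.s t * (A.kn t - B.kn t)) *\<^sub>R B.h t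
        + (A.s t * (B.kg t - A.kg t)) *\<^sub>R N2 t = a t *\<^sub>R B.e t + b t *\<^sub>R B.h t + 0 *\<^sub>R N2 t"
      using ab[OF t] angular_velocity_eq[OF t] by (simp add: scaleR_add_right)
    then have "A.s t * (A.kn t - B.kn t) = b t" "A.s t * (B.kg t - A.kg t) = 0"
      unfolding h by (rule F.frame_coeff_unique)+
    then show "A.kg t = B.kg t \<and> A.kn t \<noteq> B.kn t"
      using ab[OF t] A.regular[OF t] by auto
  qed
next
  assume R: "\<forall>t\<in>J. A.kg t = B.kg t \<and> A.kn t \<noteq> B.kn t"
  \<comment> \<open>Each term carries the speed of its own curve, so smoothness follows frame by
    frame; on \<open>J\<close> the speeds agree and these are the coefficients of the angular
    velocity.\<close>
  define a where "a t = B.s t * B.tg t - A.s t * A.tg t" for t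
  define b where "b t = A.s t * A.kn t - B.s t * B.kn t" for t
  have "smooth_on J a" "smooth_on J b"
    unfolding a_def[abs_def] b_def[abs_def]
    by (intro smooth_on_diff A.smooth_kn A.smooth_tg B.smooth_kn B.smooth_tg)+
  moreover have ab: "angular_velocity J g t = a t *\<^sub>R B.e t + b t *\<^sub>R B.h t \<and> b t \<noteq> 0" if "t \<in> J" for t
    using R that A.regular[OF that] speed[OF that] angular_velocity_eq[OF that]
    by (simp add: a_def b_def algebra_simps)
  \<comment> \<open>A zero angular matrix would force a zero angular velocity, contradicting the
    nonzero component \<open>b t\<close>.\<close>
  moreover have "angular_matrix J g t \<noteq> 0" if "t \<in> J" for t
  proof
    assume "angular_matrix J g t = 0"
    then have "angular_velocity J g t = 0" by (intro angular_velocity_eqI) simp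
    moreover interpret F: orthonormal_pair "B.e t" "N2 t" by (rule B.pair[OF that])
    have "B.h t = cross3 (N2 t) (B.e t)" by (simp add: darboux_h_def)
    ultimately show False
      using ab[OF that] F.frame_coeff_unique(2)[of "a t" "b t" 0 0 0 0] by simp
  qed
  ultimately show "standard_rolling J \<gamma> N \<gamma>2 N2 g"
    unfolding standard_rolling_def rotational_def using motion by blast
qed

end

theorem proposition2p4:
  fixes S S2 :: "(real^3) set" and \<alpha> :: real and J :: "real set"
    and \<gamma> \<gamma>2 N N2 :: "real \<Rightarrow> real^3" and g :: "real \<Rightarrow> real^3 \<Rightarrow> real^3"
  assumes "0 < \<alpha>" and "J = {0..\<alpha>}"
    and "smooth_surface S" and "smooth_surface S2"
    and "regular_curve_on J S \<gamma>" and "smooth_unit_normal_along J S \<gamma> N"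
    and "regular_curve_on J S2 \<gamma>2" and "smooth_unit_normal_along J S2 \<gamma>2 N2"
    and "\<gamma> 0 = 0" and "\<gamma>2 0 = \<gamma> 0"
    and "velocity J \<gamma>2 0 = velocity J \<gamma> 0"
    and "\<forall>t\<in>J. norm (velocity J \<gamma>2 t) = norm (velocity J \<gamma> t)"
    and "framed_motion J \<gamma> N \<gamma>2 N2 g"
  shows "standard_rolling J \<gamma> N \<gamma>2 N2 g \<longleftrightarrow>
    (\<forall>t\<in>J. geodesic_curvature J \<gamma> N t = geodesic_curvature J \<gamma>2 N2 t \<and>
           normal_curvature J \<gamma> N t \<noteq> normal_curvature J \<gamma>2 N2 t)"
proof -
  interpret A: darboux_frame J \<gamma> N by (rule darboux_frameI) fact+
  interpret B: darboux_frame J \<gamma>2 N2 by (rule darboux_frameI) fact+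
  interpret framed_motion_pair J \<gamma> \<gamma>2 N N2 g
    using assms by unfold_locales auto
  \<comment> \<open>On \<open>J\<close> the curvatures given by \<open>THE\<close> equal the
    explicit quotients \<open>kg\<close> and \<open>kn\<close> of each frame.\<close>
  show ?thesis using standard_rolling_iff by (simp add: A.curvatures B.curvatures)
qed

end
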